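(* Let $c$ be a medium with a semi-infinite defect, equal to a periodic symmetric medium $A$ for $x<x_0$ and to a periodic symmetric medium $B$ for $x>x_0$, where $A$ and $B$ have the same spectrum $\sigma$. Let $u$ be a localised eigenmode of $u''+\frac{\omega^2}{c^2(x)}u=0$ with eigenfrequency $\omega\in\mathbb{R}\setminus\sigma$. Let $(V_{11}^A(\omega),V_{21}^A(\omega))^\top$ be an eigenvector of $T_A(\omega)$ associated to its eigenvalue $\lambda_1^A$ with $|\lambda_1^A|<1$, and let $(V_{11}^B(\omega),V_{21}^B(\omega))^\top$ be an eigenvector of $T_B(\omega)$ associated to its eigenvalue $\lambda_1^B$ with $|\lambda_1^B|<1$. Then $$\begin{pmatrix}V_{21}^A(\omega)&V_{11}^A(\omega)\end{pmatrix}\begin{pmatrix}V_{11}^B(\omega)\\ V_{21}^B(\omega)\end{pmatrix}=0.$$ Furthermore, the localised eigenmode satisfies $V_{21}^B(\omega)\,u(x_0)=V_{11}^B(\omega)\,u'(x_0)$.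
   Context: Medium with a semi-infinite defect: let $h>0$ and let $\{x_n:n\in\mathbb{Z}\}\subset\mathbb{R}$ satisfy $x_{n+1}-x_n=h$ for all $n\in\mathbb{Z}$. The function $c:\mathbb{R}\to\mathbb{R}$ is strictly positive and piecewise smooth (finitely many smooth pieces on bounded intervals, with positive one-sided limits), with $c(x_n+t)=c(x_m+t)$ for all $t\in[0,h)$ whenever $n,m<0$ or $n,m\ge0$, and $c(x_n+t)=c(x_{n+1}-t)$ for all $t\in[0,h)$, $n\in\mathbb{Z}$. Medium $A$ (resp. $B$) is the $h$-periodic medium on $\mathbb{R}$ obtained by repeating the unit cell of $c$ to the left (resp. right) of $x_0$. Solutions: a solution of $u''+\frac{\omega^2}{c^2(x)}u=0$ is a nonzero $C^1$ function with locally absolutely continuous derivative satisfying the equation away from the discontinuities of $c$. A localised eigenmode is a solution $u\in L^2(\mathbb{R})$ that decays at $\pm\infty$; in particular $u(x_n)\to0$, $u'(x_n)\to0$ as $n\to\pm\infty$. Spectrum of a periodic medium: the set of $\omega$ for which the equation posed in that medium has a nonzero solution that is in $L^2(\mathbb{R})$ or satisfies $u(x+h)=e^{\mathrm{i}\alpha h}u(x)$ for some $\alpha\in\mathbb{R}$. Transfer matrices: $T_A(\omega),T_B(\omega)\in\mathbb{R}^{2\times2}$ are the matrices such that any solution satisfies $(u(x_{n+1}),u'(x_{n+1}))^\top=T_A(\omega)(u(x_n),u'(x_n))^\top$ for $n<0$ and $(u(x_{n+1}),u'(x_{n+1}))^\top=T_B(\omega)(u(x_n),u'(x_n))^\top$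 for $n\ge0$. For $\omega\in\mathbb{R}\setminus\sigma$ each of them has real eigenvalues, one of modulus less than $1$ and one of modulus greater than $1$. *)

theory Defs
  imports "HOL-Analysis.Analysis"
begin

section \<open>Media\<close>

text \<open>
  On every bounded interval the function is \<open>C\<^sup>\<infinity>\<close> off finitely many points, and all its one-sided
  limits exist and are positive.  No one-sided limits of the derivatives are required.
\<close>

definition piecewise_smooth_pos :: "(real \<Rightarrow> real) \<Rightarrow> bool" where
  "piecewise_smooth_pos c \<longleftrightarrow>
     (\<forall>a b. \<exists>S. finite S \<and>
        (\<forall>x\<in>{a<..<b} - S. \<forall>k. (deriv ^^ k) c field_differentiable (at x))) \<and>
     (\<forall>x. \<exists>l>0. (c \<longlongrightarrow> l) (at_left x)) \<and>
     (\<forall>x. \<exists>r>0. (c \<longlongrightarrow> r) (at_right x))"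

definition semi_infinite_defect :: "real \<Rightarrow> (int \<Rightarrow> real) \<Rightarrow> (real \<Rightarrow> real) \<Rightarrow> bool" where
  "semi_infinite_defect h x c \<longleftrightarrow>
     h > 0 \<and>
     (\<forall>n. x (n + 1) - x n = h) \<and>
     (\<forall>y. c y > 0) \<and>
     piecewise_smooth_pos c \<and>
     (\<forall>n m. \<forall>t\<in>{0..<h}. (n < 0 \<and> m < 0 \<or> n \<ge> 0 \<and> m \<ge> 0) \<longrightarrow> c (x n + t) = c (x m + t)) \<and>
     (\<forall>n. \<forall>t\<in>{0..<h}. c (x n + t) = c (x (n + 1) - t))"

text \<open>The \<open>h\<close>-periodic medium that agrees with \<open>c\<close> on the cell \<open>[a, a + h)\<close>.\<close>

definition repeat_cell :: "real \<Rightarrow> real \<Rightarrow> (real \<Rightarrow> real) \<Rightarrow> real \<Rightarrow> real" where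
  "repeat_cell h a c y = c (a + h * frac ((y - a) / h))"

definition medium_A :: "real \<Rightarrow> (int \<Rightarrow> real) \<Rightarrow> (real \<Rightarrow> real) \<Rightarrow> real \<Rightarrow> real" where
  "medium_A h x c = repeat_cell h (x (-1)) c"

definition medium_B :: "real \<Rightarrow> (int \<Rightarrow> real) \<Rightarrow> (real \<Rightarrow> real) \<Rightarrow> real \<Rightarrow> real" where
  "medium_B h x c = repeat_cell h (x 0) c"


section \<open>Solutions, eigenmodes and spectrum\<close>

text \<open>
  Absolute continuity of a function on a compact interval (the library constant
  \<^const>\<open>absolutely_continuous\<close> is about measures).
\<close>

definition abs_continuous_on :: "real \<Rightarrow> real \<Rightarrow> (real \<Rightarrow> complex) \<Rightarrow> bool" where
  "abs_continuous_on a b f \<longleftrightarrow>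
     (\<forall>e>0. \<exists>d>0. \<forall>n. \<forall>l r :: nat \<Rightarrow> real.
        (\<forall>i<n. a \<le> l i \<and> l i \<le> r i \<and> r i \<le> b) \<and>
        disjoint_family_on (\<lambda>i. {l i<..<r i}) {..<n} \<and>
        (\<Sum>i<n. r i - l i) < d
        \<longrightarrow> (\<Sum>i<n. norm (f (r i) - f (l i))) < e)"

definition locally_abs_continuous :: "(real \<Rightarrow> complex) \<Rightarrow> bool" where
  "locally_abs_continuous f \<longleftrightarrow> (\<forall>a b. abs_continuous_on a b f)"

abbreviation derivative :: "(real \<Rightarrow> complex) \<Rightarrow> real \<Rightarrow> complex" where
  "derivative u \<equiv> \<lambda>y. vector_derivative u (at y)"

text \<open>
  Solutions are complex-valued, as the quasi-periodicity condition below requires.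
\<close>

definition solution :: "(real \<Rightarrow> real) \<Rightarrow> real \<Rightarrow> (real \<Rightarrow> complex) \<Rightarrow> bool" where
  "solution c \<omega> u \<longleftrightarrow>
     (\<exists>y. u y \<noteq> 0) \<and>
     u C1_differentiable_on UNIV \<and>
     locally_abs_continuous (derivative u) \<and>
     (\<forall>y. isCont c y \<longrightarrow>
        (derivative u has_vector_derivative - (of_real (\<omega>\<^sup>2 / (c y)\<^sup>2) * u y)) (at y))"

definition in_L2 :: "(real \<Rightarrow> complex) \<Rightarrow> bool" where
  "in_L2 u \<longleftrightarrow> u \<in> borel_measurable lborel \<and> integrable lborel (\<lambda>y. (norm (u y))\<^sup>2)"

text \<open>
  Decay is only required of \<open>u\<close>; decay of \<open>u'\<close> is a consequence, by the equation, when \<open>c\<close> is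
  bounded away from \<open>0\<close>.
\<close>

definition localised_eigenmode :: "(real \<Rightarrow> real) \<Rightarrow> real \<Rightarrow> (real \<Rightarrow> complex) \<Rightarrow> bool" where
  "localised_eigenmode c \<omega> u \<longleftrightarrow>
     solution c \<omega> u \<and> in_L2 u \<and> (u \<longlongrightarrow> 0) at_top \<and> (u \<longlongrightarrow> 0) at_bot"

definition spectrum :: "real \<Rightarrow> (real \<Rightarrow> real) \<Rightarrow> real set" where
  "spectrum h c = {\<omega>. \<exists>u. solution c \<omega> u \<and>
     (in_L2 u \<or> (\<exists>\<alpha>::real. \<forall>y. u (y + h) = exp (\<i> * of_real \<alpha> * of_real h) * u y))}"


section \<open>Transfer matrices\<close>

definition cauchy_data :: "(real \<Rightarrow> complex) \<Rightarrow> real \<Rightarrow> complex^2" where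
  "cauchy_data u y = vector [u y, derivative u y]"

text \<open>
  The real matrix \<open>T\<close> transfers the Cauchy data of every solution across each cell
  \<open>[x\<^sub>n, x\<^sub>n\<^sub>+\<^sub>1]\<close> with \<open>n \<in> N\<close>; its entries are embedded into the complex numbers to act on them.
\<close>

definition transfer_matrix ::
    "(real \<Rightarrow> real) \<Rightarrow> real \<Rightarrow> (int \<Rightarrow> real) \<Rightarrow> int set \<Rightarrow> real^2^2 \<Rightarrow> bool" where
  "transfer_matrix c \<omega> x N T \<longleftrightarrow>
     (\<forall>u. solution c \<omega> u \<longrightarrow>
        (\<forall>n\<in>N. cauchy_data u (x (n + 1)) =
           (\<chi> i j. complex_of_real (T $ i $ j)) *v cauchy_data u (x n)))"

end

theory Submission
  imports Defs
begin

text \<open>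
  Write \<open>S = diag (1, -1)\<close> for the action on Cauchy data of reflection in a point.  Because each cell
  is symmetric, reflecting a solution in the centre of a cell gives a solution on that cell, and the
  transfer matrix \<open>T\<close> of the cell satisfies \<open>T S T = S\<close>.  Hence if \<open>V\<close> is an eigenvector of \<open>T\<close> for an
  eigenvalue \<open>\<lambda>\<close> with \<open>\<bar>\<lambda>\<bar> < 1\<close>, then \<open>S V\<close> is an eigenvector for \<open>1 / \<lambda>\<close>, and an orbit of \<open>T\<close> whose
  first coordinate tends to \<open>0\<close> stays on the line of \<open>V\<close>
  (\<open>decaying_orbit_parallel_eigenvector\<close>).  To the right of \<open>x\<^sub>0\<close> this puts the data \<open>(u, u')\<close> of the
  eigenmode at \<open>x\<^sub>0\<close> on the line of \<open>V\<^sup>B\<close>.  To the left, the reflected data \<open>S (u, u')\<close> at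
  \<open>x\<^sub>0, x\<^sub>-\<^sub>1, x\<^sub>-\<^sub>2, \<dots>\<close> form an orbit of \<open>T\<^sub>A\<close>, so that \<open>(u, - u')\<close> at \<open>x\<^sub>0\<close> is on the line of \<open>V\<^sup>A\<close>.
  As the data of a nonzero solution never vanish (\<open>cauchy_data_nonzero\<close>), these two linear conditions
  are dependent, and their determinant is the quantity claimed to be zero.

  The transfer matrix is only constrained by its action on solutions, so \<open>T S T = S\<close>
  needs two independent global solutions.  One is the eigenmode; \<open>second_solution\<close> constructs another
  with Wronskian \<open>1\<close> by an explicit formula and one integration.  The relation \<open>T S T = S\<close> amounts to
  \<open>det T = 1\<close> and equality of the diagonal entries, and both are read off from constant Wronskians
  (\<open>symmetric_cell_transfer_matrix\<close>).
\<close>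

section \<open>Monotonicity with finitely many exceptional points\<close>

text \<open>
  The equation only holds off the discontinuities of the coefficient, so the basic calculus facts
  are needed with finitely many exceptional points; the fundamental theorem of calculus tolerates
  them.
\<close>

lemma nonneg_derivative_imp_le_off_finite:
  fixes f f' :: "real \<Rightarrow> real"
  assumes "a \<le> b" "finite S" "continuous_on {a..b} f"
    and "\<And>y. y \<in> {a<..<b} - S \<Longrightarrow> (f has_vector_derivative f' y) (at y)"
    and "\<And>y. y \<in> {a<..<b} - S \<Longrightarrow> f' y \<ge> 0"
  shows "f a \<le> f b"
proof -
  define g where "g y = (if y \<in> {a<..<b} - S then f' y else 0)" for y
  have "(g has_integral (f b - f a)) {a..b}"
    by (rule fundamental_theorem_of_calculus_interior_strong[OF assms(2,1) _ assms(3)])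
       (simp add: g_def assms(4))
  then have "0 \<le> f b - f a"
    by (rule has_integral_nonneg) (auto simp: g_def assms(5))
  then show ?thesis by simp
qed

text \<open>
  Since \<open>\<bar>f'\<bar> \<le> L f\<close>, the products of \<open>f\<close> with \<open>exp (L y)\<close> and \<open>exp (- L y)\<close> are monotone in opposite
  directions.  Both are kept, so that vanishing at either end point propagates to the other.
\<close>

lemma gronwall_off_finite:
  fixes f f' :: "real \<Rightarrow> real"
  assumes "a \<le> b" "finite S" and cont: "continuous_on {a..b} f"
    and der: "\<And>y. y \<in> {a<..<b} - S \<Longrightarrow> (f has_vector_derivative f' y) (at y)"
    and bound: "\<And>y. y \<in> {a<..<b} - S \<Longrightarrow> \<bar>f' y\<bar> \<le> L * f y"
  shows "exp (L * a) * f a \<le> exp (L * b) * f b"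
    and "exp (- L * b) * f b \<le> exp (- L * a) * f a"
proof -
  have E: "((\<lambda>y. exp (k * y)) has_vector_derivative k * exp (k * y)) (at y)" for k y :: real
    by (auto intro!: derivative_eq_intros simp: has_real_derivative_iff_has_vector_derivative[symmetric])
  show "exp (L * a) * f a \<le> exp (L * b) * f b"
  proof (rule nonneg_derivative_imp_le_off_finite[OF assms(1,2)])
    show "continuous_on {a..b} (\<lambda>y. exp (L * y) * f y)"
      by (intro continuous_intros cont)
    show "((\<lambda>y. exp (L * y) * f y) has_vector_derivative
        exp (L * y) * f' y + L * exp (L * y) * f y) (at y)" if "y \<in> {a<..<b} - S" for y
      by (intro has_vector_derivative_mult E der that)
    show "0 \<le> exp (L * y) * f' y + L * exp (L * y) * f y" if "y \<in> {a<..<b} - S" for y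
    proof -
      have "0 \<le> exp (L * y) * (f' y + L * f y)"
        using bound[OF that] by (intro mult_nonneg_nonneg) auto
      then show ?thesis by (simp add: algebra_simps)
    qed
  qed
  have "- (exp (- L * a) * f a) \<le> - (exp (- L * b) * f b)"
  proof (rule nonneg_derivative_imp_le_off_finite[OF assms(1,2)])
    show "continuous_on {a..b} (\<lambda>y. - (exp (- L * y) * f y))"
      by (intro continuous_intros cont)
    show "((\<lambda>y. - (exp (- L * y) * f y)) has_vector_derivative
        - (exp (- L * y) * f' y + (- L) * exp (- L * y) * f y)) (at y)" if "y \<in> {a<..<b} - S" for y
      by (intro has_vector_derivative_minus has_vector_derivative_mult E der that)
    show "0 \<le> - (exp (- L * y) * f' y + (- L) * exp (- L * y) * f y)" if "y \<in> {a<..<b} - S" for y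
    proof -
      have "0 \<le> exp (- L * y) * (L * f y - f' y)"
        using bound[OF that] by (intro mult_nonneg_nonneg) auto
      then show ?thesis by (simp add: algebra_simps)
    qed
  qed
  then show "exp (- L * b) * f b \<le> exp (- L * a) * f a" by simp
qed

section \<open>Second-order equations with a piecewise continuous coefficient\<close>

text \<open>
  The setting for \<open>u'' + q u = 0\<close>, applied below with \<open>q = \<omega>\<^sup>2 / c\<^sup>2\<close>.  The exceptional set \<open>D\<close> is
  kept separate from the set of discontinuities of \<open>q\<close>: the two may differ for \<open>\<omega> = 0\<close>, where \<open>q\<close> is
  continuous but solutions are only required to satisfy the equation where \<open>c\<close> is continuous.
\<close>

locale piecewise_continuous_coefficient =
  fixes q :: "real \<Rightarrow> real" and D :: "real set"
  assumes finite_exceptions: "\<And>a b. finite (D \<inter> {a..b})"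
    and locally_bounded: "\<And>a b. \<exists>K. \<forall>y\<in>{a..b}. \<bar>q y\<bar> \<le> K"
    and continuous_off: "\<And>y. y \<notin> D \<Longrightarrow> isCont q y"
begin

text \<open>
  The equation as a first-order system for \<open>(u, w)\<close> on a bounded interval, so that a solution may be
  reflected in one cell without any extension to the real line.
\<close>

definition solves_on :: "real \<Rightarrow> real \<Rightarrow> (real \<Rightarrow> complex) \<Rightarrow> (real \<Rightarrow> complex) \<Rightarrow> bool" where
  "solves_on a b u w \<longleftrightarrow>
     continuous_on {a..b} u \<and> continuous_on {a..b} w \<and>
     (\<forall>y\<in>{a<..<b} - D. (u has_vector_derivative w y) (at y) \<and>
        (w has_vector_derivative - (of_real (q y) * u y)) (at y))"

lemma solves_onD:
  assumes "solves_on a b u w"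
  shows "continuous_on {a..b} u" "continuous_on {a..b} w"
    and "\<And>y. y \<in> {a<..<b} - D \<inter> {a..b} \<Longrightarrow> (u has_vector_derivative w y) (at y)"
    and "\<And>y. y \<in> {a<..<b} - D \<inter> {a..b} \<Longrightarrow>
      (w has_vector_derivative - (of_real (q y) * u y)) (at y)"
  using assms by (auto simp: solves_on_def)

text \<open>
  The Wronskian has derivative zero because the system has trace zero.  Constancy of this single
  quantity replaces a uniqueness theorem in the comparison of solutions on one cell.
\<close>

lemma wronskian_constant:
  assumes "a \<le> b" and u: "solves_on a b u w" and v: "solves_on a b v z"
  shows "u b * z b - w b * v b = u a * z a - w a * v a"
proof -
  have "((\<lambda>y. 0) has_integral (u b * z b - w b * v b) - (u a * z a - w a * v a)) {a..b}"
  proof (rule fundamental_theorem_of_calculus_interior_strong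
      [OF finite_exceptions[of a b] assms(1), where f = "\<lambda>y. u y * z y - w y * v y"])
    show "continuous_on {a..b} (\<lambda>y. u y * z y - w y * v y)"
      by (intro continuous_intros solves_onD[OF u] solves_onD[OF v])
    fix y assume y: "y \<in> {a<..<b} - D \<inter> {a..b}"
    show "((\<lambda>y. u y * z y - w y * v y) has_vector_derivative 0) (at y)"
      by (rule has_vector_derivative_eq_rhs, (rule derivative_intros
            solves_onD(3,4)[OF u y] solves_onD(3,4)[OF v y])+) (simp add: algebra_simps)
  qed
  then show ?thesis by (simp add: has_integral_0_eq)
qed

text \<open>
  The energy satisfies \<open>E' = 2 (1 - q) Re (cnj u * w)\<close>, which is at most \<open>(1 + sup \<bar>q\<bar>) E\<close> in modulus,
  so that Gronwall's inequality applies in both directions.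
\<close>

lemma energy_zero_iff:
  assumes "a \<le> b" and u: "solves_on a b u w"
    and E: "\<And>y. E y = (cmod (u y))\<^sup>2 + (cmod (w y))\<^sup>2"
  shows "E a = 0 \<longleftrightarrow> E b = 0"
proof -
  obtain K where K: "\<And>y. y \<in> {a..b} \<Longrightarrow> \<bar>q y\<bar> \<le> K" using locally_bounded[of a b] by blast
  define E' where "E' y = Re (of_real (1 - q y) * (cnj (u y) * w y + u y * cnj (w y)))" for y
  have E_Re: "E = (\<lambda>y. Re (u y * cnj (u y) + w y * cnj (w y)))"
    by (rule ext) (simp only: E complex_norm_square[symmetric] of_real_add[symmetric] Re_complex_of_real)
  have cont: "continuous_on {a..b} E"
    unfolding E_Re by (intro continuous_intros solves_onD[OF u])
  have der: "(E has_vector_derivative E' y) (at y)" if y: "y \<in> {a<..<b} - D \<inter> {a..b}" for y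
    unfolding E_Re E'_def
    by (rule bounded_linear.has_vector_derivative[OF bounded_linear_Re],
        rule has_vector_derivative_eq_rhs, (rule derivative_intros solves_onD(3,4)[OF u y])+)
       (simp add: algebra_simps)
  have bound: "\<bar>E' y\<bar> \<le> (1 + K) * E y" if y: "y \<in> {a<..<b} - D \<inter> {a..b}" for y
  proof -
    have "\<bar>E' y\<bar> \<le> cmod (of_real (1 - q y) * (cnj (u y) * w y + u y * cnj (w y)))"
      unfolding E'_def by (rule abs_Re_le_cmod)
    also have "\<dots> = \<bar>1 - q y\<bar> * cmod (cnj (u y) * w y + u y * cnj (w y))"
      by (simp only: norm_mult norm_of_real)
    also have "\<dots> \<le> (1 + K) * (cmod (u y) * cmod (w y) + cmod (u y) * cmod (w y))"
    proof (rule mult_mono)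
      show "\<bar>1 - q y\<bar> \<le> 1 + K" using K[of y] y by auto
      then show "0 \<le> 1 + K" by linarith
      show "cmod (cnj (u y) * w y + u y * cnj (w y))
          \<le> cmod (u y) * cmod (w y) + cmod (u y) * cmod (w y)"
        by (rule order_trans[OF norm_triangle_ineq]) (simp add: norm_mult)
    qed simp
    also have "\<dots> \<le> (1 + K) * E y"
    proof (rule mult_left_mono)
      show "cmod (u y) * cmod (w y) + cmod (u y) * cmod (w y) \<le> E y"
        using sum_squares_bound[of "cmod (u y)" "cmod (w y)"] by (simp add: E)
      show "0 \<le> 1 + K" using K[of y] y by auto
    qed
    finally show ?thesis .
  qed
  have nonneg: "E a \<ge> 0" "E b \<ge> 0" by (simp_all add: E)
  note g = gronwall_off_finite[OF assms(1) finite_exceptions[of a b] cont, of E' "1 + K",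
      OF der bound]
  show ?thesis
  proof
    assume "E a = 0"
    then have "exp (- (1 + K) * b) * E b \<le> 0" using g(2) by (metis mult_zero_right)
    then show "E b = 0" using nonneg by (simp add: mult_le_0_iff)
  next
    assume "E b = 0"
    then have "exp ((1 + K) * a) * E a \<le> 0" using g(1) by (metis mult_zero_right)
    then show "E a = 0" using nonneg by (simp add: mult_le_0_iff)
  qed
qed

lemma cauchy_data_nonzero:
  assumes u: "\<And>a b. solves_on a b u w" and nz: "u y0 \<noteq> 0"
  shows "u y \<noteq> 0 \<or> w y \<noteq> 0"
proof -
  have "(cmod (u y))\<^sup>2 + (cmod (w y))\<^sup>2 = 0 \<longleftrightarrow> (cmod (u y0))\<^sup>2 + (cmod (w y0))\<^sup>2 = 0"
  proof (cases "y \<le> y0")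
    case True
    then show ?thesis by (rule energy_zero_iff[OF _ u refl])
  next
    case False
    then show ?thesis using energy_zero_iff[OF _ u refl, of y0 y] by simp
  qed
  then show ?thesis using nz by (auto simp: sum_power2_eq_zero_iff)
qed

lemma exists_primitive:
  fixes g :: "real \<Rightarrow> complex"
  assumes cont: "\<And>y. y \<notin> D \<Longrightarrow> isCont g y"
    and bdd: "\<And>a b. \<exists>B. \<forall>y\<in>{a..b}. norm (g y) \<le> B"
  obtains G where "continuous_on UNIV G"
    and "\<And>y. y \<notin> D \<Longrightarrow> (G has_vector_derivative g y) (at y)"
proof -
  have "countable (\<Union>n::nat. D \<inter> {- real n..real n})"
    by (rule countable_UN) (auto intro: countable_finite finite_exceptions)
  moreover have "D = (\<Union>n::nat. D \<inter> {- real n..real n})"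
  proof (intro equalityI subsetI)
    fix y assume "y \<in> D"
    moreover obtain n :: nat where "\<bar>y\<bar> \<le> real n" using real_arch_simple by blast
    ultimately show "y \<in> (\<Union>n::nat. D \<inter> {- real n..real n})"
      by (intro UN_I[of n]) auto
  qed auto
  ultimately have "countable D" by simp
  \<comment> \<open>A function with countably many discontinuities is Borel measurable; as \<open>g\<close> is also locally bounded,
    it is locally integrable.\<close>
  then have meas: "g \<in> borel_measurable borel"
    by (rule borel_measurable_continuous_countable_exceptions)
       (auto intro: continuous_at_imp_continuous_on cont)
  have int: "g integrable_on {a..b}" for a b
  proof -
    obtain B where B: "\<And>y. y \<in> {a..b} \<Longrightarrow> norm (g y) \<le> B" using bdd[of a b] by blast
    show ?thesis
    proof (rule measurable_bounded_by_integrable_imp_integrable)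
      show "g \<in> borel_measurable (lebesgue_on {a..b})"
        by (intro measurable_restrict_space1 measurable_completion) (use meas in simp)
      show "(\<lambda>_. B) integrable_on {a..b}" by (rule integrable_const_ivl)
    qed (auto intro: B)
  qed
  \<comment> \<open>Exactly one of the two integrals is over a non-degenerate interval, unless \<open>y = 0\<close>.\<close>
  define G where "G y = integral {0..y} g - integral {y..0} g" for y
  have G: "G y = integral {-r..y} g - integral {-r..0} g" if "-r \<le> y" "0 \<le> r" for r y
  proof (cases "0 \<le> y")
    case True
    have "integral {y..0} g = 0"
      using True by (cases "y = 0") auto
    then show ?thesis
      using Henstock_Kurzweil_Integration.integral_combine[of "-r" 0 y g] that True int
      by (simp add: G_def algebra_simps)
  next
    case False
    then show ?thesis
      using Henstock_Kurzweil_Integration.integral_combine[of "-r" y 0 g] that int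
      by (simp add: G_def algebra_simps)
  qed
  show thesis
  proof (rule that)
    have "isCont G y" for y
    proof -
      define r where "r = \<bar>y\<bar> + 1"
      have "0 \<le> r" by (simp add: r_def)
      have "continuous_on {-r<..<r} (\<lambda>y. integral {-r..y} g - integral {-r..0} g)"
        by (intro continuous_intros continuous_on_subset[OF indefinite_integral_continuous_1[OF int[of "-r" r]]])
           auto
      then have "continuous_on {-r<..<r} G"
        by (rule continuous_on_eq) (use G[of r] \<open>0 \<le> r\<close> in auto)
      then show ?thesis
        by (subst (asm) continuous_on_eq_continuous_at) (auto simp: r_def abs_if split: if_splits)
    qed
    then show "continuous_on UNIV G" by (simp add: continuous_on_eq_continuous_at)
    fix y assume y: "y \<notin> D"
    define r where "r = \<bar>y\<bar> + 1"
    have r: "-r < y" "y < r" "0 \<le> r" unfolding r_def by linarith+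
    have "((\<lambda>y. integral {-r..y} g) has_vector_derivative g y) (at y within {-r..r} - {})"
      by (rule integral_has_vector_derivative_continuous_at[OF int])
         (use r cont[OF y] in \<open>auto intro: continuous_at_imp_continuous_at_within\<close>)
    then have "((\<lambda>y. integral {-r..y} g) has_vector_derivative g y) (at y within {-r<..<r})"
      by (rule has_vector_derivative_within_subset) auto
    then have "((\<lambda>y. integral {-r..y} g) has_vector_derivative g y) (at y)"
      by (subst (asm) at_within_open) (use r in auto)
    then have "((\<lambda>y. integral {-r..y} g - integral {-r..0} g) has_vector_derivative g y) (at y)"
      using has_vector_derivative_diff[OF _ has_vector_derivative_const] by fastforce
    then show "(G has_vector_derivative g y) (at y)"
      by (rule has_vector_derivative_transform_within_open[of _ _ _ "{-r<..<r}"])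
         (use r G[of r] in auto)
  qed
qed

text \<open>
  Reduction of order in a form that survives zeros of \<open>u\<close>.  The usual ansatz
  \<open>v = u \<integral> u\<^sup>-\<^sup>2\<close> is singular at the zeros of \<open>u\<close>; instead one writes the data of \<open>v\<close> as
  \<open>(v, z) = a (u, w) + (- cnj w, cnj u) / N\<close> with \<open>N = \<bar>u\<bar>\<^sup>2 + \<bar>w\<bar>\<^sup>2\<close>, which never vanishes.  The second
  vector is orthogonal to \<open>(u, w)\<close> and normalised so that the Wronskian is \<open>1\<close> whatever \<open>a\<close> is, and
  the differential system becomes the explicit condition
  \<open>a' = (1 - q) (cnj u\<^sup>2 - cnj w\<^sup>2) / N\<^sup>2\<close>, solved by a single integration.
\<close>

lemma second_solution:
  assumes u: "\<And>a b. solves_on a b u w" and nz: "u y0 \<noteq> 0"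
  obtains v z where "\<And>a b. solves_on a b v z" "\<And>y. u y * z y - w y * v y = 1"
proof -
  define N where "N y = u y * cnj (u y) + w y * cnj (w y)" for y
  have N_eq: "N y = of_real ((cmod (u y))\<^sup>2 + (cmod (w y))\<^sup>2)" for y
    by (simp only: N_def complex_norm_square[symmetric] of_real_add)
  have N0: "N y \<noteq> 0" for y
    using cauchy_data_nonzero[OF u nz, of y]
    by (auto simp: N_eq sum_power2_eq_zero_iff simp flip: of_real_add of_real_power)
  have cont: "isCont u y" "isCont w y" for y
  proof -
    have "continuous_on {y-1<..<y+1} u" "continuous_on {y-1<..<y+1} w"
      using solves_onD(1,2)[OF u, of "y-1" "y+1"] by (auto elim: continuous_on_subset)
    then show "isCont u y" "isCont w y"
      by (simp_all add: continuous_on_eq_continuous_at)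
  qed
  have du: "(u has_vector_derivative w y) (at y)"
    and dw: "(w has_vector_derivative - (of_real (q y) * u y)) (at y)" if "y \<notin> D" for y
    using solves_onD(3,4)[OF u, of y "y-1" "y+1"] that by auto
  define k where "k y = ((cnj (u y))\<^sup>2 - (cnj (w y))\<^sup>2) / (N y)\<^sup>2" for y
  have contN: "isCont N y" for y
    unfolding N_def by (intro continuous_intros cont)
  have contk: "isCont k y" for y
    unfolding k_def using N0 by (intro continuous_intros cont contN) auto
  define g where "g y = of_real (1 - q y) * k y" for y
  have "isCont g y" if "y \<notin> D" for y
    unfolding g_def by (intro continuous_intros continuous_off that contk)
  moreover have "\<exists>B. \<forall>y\<in>{a..b}. norm (g y) \<le> B" for a b
  proof -
    obtain K where K: "\<And>y. y \<in> {a..b} \<Longrightarrow> \<bar>q y\<bar> \<le> K" using locally_bounded[of a b] by blast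
    have "compact (k ` {a..b})"
      by (intro compact_continuous_image continuous_at_imp_continuous_on ballI contk) auto
    then obtain M where M: "\<And>y. y \<in> {a..b} \<Longrightarrow> norm (k y) \<le> M"
      by (meson bounded_iff compact_imp_bounded imageI)
    have "norm (g y) \<le> (1 + K) * M" if "y \<in> {a..b}" for y
      unfolding g_def norm_mult norm_of_real
      using K[OF that] M[OF that] by (intro mult_mono) auto
    then show ?thesis by blast
  qed
  ultimately obtain a where conta: "continuous_on UNIV a"
    and da: "\<And>y. y \<notin> D \<Longrightarrow> (a has_vector_derivative g y) (at y)"
    using exists_primitive by blast
  have conta: "isCont a y" for y using conta by (simp add: continuous_on_eq_continuous_at)
  \<comment> \<open>The derivative of \<open>v\<close> is \<open>z\<close> and that of \<open>z\<close> is \<open>- q v\<close> after clearing the denominator \<open>N\<^sup>2\<close>;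
    both identities become polynomial once \<open>N\<close> is expanded.\<close>
  define v where "v y = a y * u y - cnj (w y) / N y" for y
  define z where "z y = a y * w y + cnj (u y) / N y" for y
  have dN: "(N has_vector_derivative of_real (1 - q y) * (cnj (u y) * w y + u y * cnj (w y))) (at y)"
    if "y \<notin> D" for y
    unfolding N_def
    by (rule has_vector_derivative_eq_rhs, (rule derivative_intros du dw that)+)
       (simp add: algebra_simps)
  have dI: "((\<lambda>y. inverse (N y)) has_vector_derivative
      - (of_real (1 - q y) * (cnj (u y) * w y + u y * cnj (w y))) / (N y)\<^sup>2) (at y)"
    if "y \<notin> D" for y
    using field_vector_diff_chain_at[OF dN[OF that] DERIV_inverse[OF N0]]
    by (simp add: o_def power2_eq_square divide_simps N0)
  have dv: "(v has_vector_derivative z y) (at y)" if "y \<notin> D" for y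
    unfolding v_def divide_inverse
  proof (rule has_vector_derivative_eq_rhs, (rule derivative_intros du dw da dI that)+)
    show "a y * w y + g y * u y -
        (cnj (w y) * (- (of_real (1 - q y) * (cnj (u y) * w y + u y * cnj (w y))) / (N y)\<^sup>2)
          + cnj (- (of_real (q y) * u y)) * inverse (N y)) = z y"
      unfolding z_def g_def k_def using N0[of y]
      apply (simp add: divide_simps power2_eq_square)
      apply (simp add: N_def algebra_simps)
      done
  qed
  have dz: "(z has_vector_derivative - (of_real (q y) * v y)) (at y)" if "y \<notin> D" for y
    unfolding z_def divide_inverse
  proof (rule has_vector_derivative_eq_rhs, (rule derivative_intros du dw da dI that)+)
    show "a y * - (of_real (q y) * u y) + g y * w y +
        (cnj (u y) * (- (of_real (1 - q y) * (cnj (u y) * w y + u y * cnj (w y))) / (N y)\<^sup>2)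
          + cnj (w y) * inverse (N y)) = - (of_real (q y) * v y)"
      unfolding v_def g_def k_def using N0[of y]
      apply (simp add: divide_simps power2_eq_square)
      apply (simp add: N_def algebra_simps)
      done
  qed
  show thesis
  proof (rule that)
    show "solves_on a' b' v z" for a' b'
      unfolding solves_on_def
    proof (intro conjI ballI)
      show "continuous_on {a'..b'} v" "continuous_on {a'..b'} z"
        unfolding v_def z_def
        by (intro continuous_at_imp_continuous_on ballI continuous_intros conta cont contN N0)+
    qed (auto intro: dv dz)
    show "u y * z y - w y * v y = 1" for y
      unfolding v_def z_def using N0[of y]
      apply (simp add: divide_simps)
      apply (simp add: N_def algebra_simps)
      done
  qed
qed

text \<open>
  At an exceptional point the derivative of \<open>u\<close> still exists, because \<open>u\<close> is an integral of the
  continuous function \<open>w\<close>.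
\<close>

lemma solves_everywhere_imp_C1:
  assumes u: "\<And>a b. solves_on a b u w"
  shows "(u has_vector_derivative w y) (at y)"
proof -
  let ?a = "y - 1" and ?b = "y + 1"
  have *: "u t = u ?a + integral {?a..t} w" if t: "t \<in> {?a<..<?b}" for t
  proof -
    have "(w has_integral (u t - u ?a)) {?a..t}"
      using t by (intro fundamental_theorem_of_calculus_interior_strong[OF finite_exceptions[of ?a t]]
        solves_onD[OF u]) auto
    then show ?thesis by (simp add: integral_unique)
  qed
  have "((\<lambda>t. integral {?a..t} w) has_vector_derivative w y) (at y within {?a..?b})"
    by (rule integral_has_vector_derivative[OF solves_onD(2)[OF u]]) auto
  then have "((\<lambda>t. integral {?a..t} w) has_vector_derivative w y) (at y within {?a<..<?b})"
    by (rule has_vector_derivative_within_subset) auto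
  then have "((\<lambda>t. integral {?a..t} w) has_vector_derivative w y) (at y)"
    by (subst (asm) at_within_open) auto
  then have "((\<lambda>t. u ?a + integral {?a..t} w) has_vector_derivative w y) (at y)"
    using has_vector_derivative_add[OF has_vector_derivative_const] by fastforce
  then show ?thesis
    by (rule has_vector_derivative_transform_within_open[of _ _ _ "{?a<..<?b}"]) (auto simp: *)
qed

text \<open>
  On a bounded interval \<open>w\<close> is Lipschitz, since its derivative \<open>- q u\<close> is bounded there.
\<close>

lemma solves_everywhere_imp_abs_continuous:
  assumes u: "\<And>a b. solves_on a b u w"
  shows "locally_abs_continuous w"
  unfolding locally_abs_continuous_def abs_continuous_on_def
proof (intro allI impI)
  fix a b e :: real assume e: "e > 0"
  obtain K where K: "\<And>y. y \<in> {a..b} \<Longrightarrow> \<bar>q y\<bar> \<le> K" using locally_bounded[of a b] by blast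
  have "compact (u ` {a..b})"
    by (intro compact_continuous_image solves_onD[OF u]) auto
  then obtain M where M: "\<And>y. y \<in> {a..b} \<Longrightarrow> norm (u y) \<le> M"
    by (meson bounded_iff compact_imp_bounded imageI)
  \<comment> \<open>The summand \<open>1\<close> makes \<open>L\<close> positive, so that \<open>e / L\<close> is a legitimate choice below.\<close>
  define L where "L = \<bar>K\<bar> * \<bar>M\<bar> + 1"
  have L: "L > 0" by (simp add: L_def add_nonneg_pos)
  have lip: "norm (w r - w l) \<le> L * (r - l)" if lr: "a \<le> l" "l \<le> r" "r \<le> b" for l r
  proof -
    have "((\<lambda>y. - (of_real (q y) * u y)) has_integral (w r - w l)) {l..r}"
      using lr by (intro fundamental_theorem_of_calculus_interior_strong
          [OF finite_exceptions[of l r]] solves_onD[OF u]) auto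
    then have "norm (w r - w l) \<le> L * measure lborel (cbox l r)"
    proof (intro has_integral_bound)
      fix y assume "y \<in> cbox l r"
      then have y: "y \<in> {a..b}" using lr by auto
      have "norm (- (of_real (q y) * u y)) = \<bar>q y\<bar> * norm (u y)" by (simp add: norm_mult)
      also have "\<dots> \<le> \<bar>K\<bar> * \<bar>M\<bar>" using K[OF y] M[OF y] by (intro mult_mono) auto
      finally show "norm (- (of_real (q y) * u y)) \<le> L" by (simp add: L_def)
    qed (use L in auto)
    then show ?thesis using lr by simp
  qed
  show "\<exists>d>0. \<forall>n. \<forall>l r :: nat \<Rightarrow> real.
        (\<forall>i<n. a \<le> l i \<and> l i \<le> r i \<and> r i \<le> b) \<and>
        disjoint_family_on (\<lambda>i. {l i<..<r i}) {..<n} \<and>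
        (\<Sum>i<n. r i - l i) < d
        \<longrightarrow> (\<Sum>i<n. norm (w (r i) - w (l i))) < e"
  proof (intro exI[of _ "e / L"] conjI allI impI)
    show "e / L > 0" using e L by simp
    fix n and l r :: "nat \<Rightarrow> real"
    assume H: "(\<forall>i<n. a \<le> l i \<and> l i \<le> r i \<and> r i \<le> b) \<and>
        disjoint_family_on (\<lambda>i. {l i<..<r i}) {..<n} \<and> (\<Sum>i<n. r i - l i) < e / L"
    have "(\<Sum>i<n. norm (w (r i) - w (l i))) \<le> (\<Sum>i<n. L * (r i - l i))"
      using H by (intro sum_mono lip) auto
    also have "\<dots> = L * (\<Sum>i<n. r i - l i)" by (simp add: sum_distrib_left)
    also have "\<dots> < e" using H L by (simp add: field_simps)
    finally show "(\<Sum>i<n. norm (w (r i) - w (l i))) < e" .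
  qed
qed

end

section \<open>Solutions in a piecewise smooth medium\<close>

text \<open>
  Near each point the two one-sided limits and the value itself bound \<open>c\<close> from below; Bolzano's
  subdivision principle makes the bound uniform on a compact interval.
\<close>

lemma exists_positive_lower_bound:
  fixes c :: "real \<Rightarrow> real"
  assumes pos: "\<And>y. c y > 0"
    and left: "\<And>y. \<exists>l>0. (c \<longlongrightarrow> l) (at_left y)"
    and right: "\<And>y. \<exists>l>0. (c \<longlongrightarrow> l) (at_right y)"
  shows "\<exists>m>0. \<forall>y\<in>{a..b}. m \<le> c y"
proof (cases "a \<le> b")
  case True
  then show ?thesis
  proof (induction rule: Bolzano)
    case (trans a b d)
    then obtain m1 m2 where "m1 > 0" "m2 > 0" "\<forall>y\<in>{a..b}. m1 \<le> c y" "\<forall>y\<in>{b..d}. m2 \<le> c y" by blast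
    then show ?case by (intro exI[of _ "min m1 m2"]) (auto simp: min_le_iff_disj)
  next
    case (local t)
    obtain l where l: "l > 0" "(c \<longlongrightarrow> l) (at_left t)" using left by blast
    obtain r where r: "r > 0" "(c \<longlongrightarrow> r) (at_right t)" using right by blast
    define m where "m = min (c t) (min (l / 2) (r / 2))"
    have m: "m > 0" "m < l" "m < r" "m \<le> c t"
      using l r pos[of t] by (auto simp: m_def min_def)
    have "eventually (\<lambda>y. m < c y) (at_left t)" "eventually (\<lambda>y. m < c y) (at_right t)"
      using l r m by (auto intro: order_tendstoD(1))
    then have "eventually (\<lambda>y. m < c y) (at t)" by (simp add: eventually_at_split)
    then obtain d where "d > 0" and d: "\<And>y. y \<noteq> t \<Longrightarrow> dist y t < d \<Longrightarrow> m < c y"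
      by (auto simp: eventually_at)
    have "m \<le> c y" if "dist y t < d" for y
      using d[of y] that m by (cases "y = t") auto
    then show ?case using \<open>d > 0\<close> m
      by (intro exI[of _ d]) (fastforce simp: dist_real_def)
  qed
next
  case False
  then show ?thesis by (intro exI[of _ 1]) auto
qed

lemma piecewise_smooth_imp_coefficient:
  assumes pos: "\<And>y. c y > 0" and c: "piecewise_smooth_pos c"
  shows "piecewise_continuous_coefficient (\<lambda>y. \<omega>\<^sup>2 / (c y)\<^sup>2) {y. \<not> isCont c y}"
proof
  fix a b :: real
  obtain S where "finite S"
    and S: "\<forall>y\<in>{a-1<..<b+1} - S. \<forall>k. (deriv ^^ k) c field_differentiable (at y)"
    using c unfolding piecewise_smooth_pos_def by meson
  have "isCont c y" if "y \<in> {a..b} - S" for y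
  proof -
    have "(deriv ^^ 0) c field_differentiable (at y)" using S that by fastforce
    then show ?thesis by (simp add: field_differentiable_imp_continuous_at)
  qed
  then have "{y. \<not> isCont c y} \<inter> {a..b} \<subseteq> S" by blast
  then show "finite ({y. \<not> isCont c y} \<inter> {a..b})" using \<open>finite S\<close> by (rule finite_subset)
  obtain m where m: "m > 0" "\<forall>y\<in>{a..b}. m \<le> c y"
    using exists_positive_lower_bound[of c a b] pos c unfolding piecewise_smooth_pos_def by blast
  have "\<bar>\<omega>\<^sup>2 / (c y)\<^sup>2\<bar> \<le> \<omega>\<^sup>2 / m\<^sup>2" if "y \<in> {a..b}" for y
    using m that pos[of y]
    by (auto intro!: divide_left_mono power_mono mult_pos_pos zero_less_power simp: order_less_imp_le)
  then show "\<exists>K. \<forall>y\<in>{a..b}. \<bar>\<omega>\<^sup>2 / (c y)\<^sup>2\<bar> \<le> K" by blast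
next
  fix y assume "y \<notin> {y. \<not> isCont c y}"
  then show "isCont (\<lambda>y. \<omega>\<^sup>2 / (c y)\<^sup>2) y"
    using pos[of y] by (intro continuous_intros) auto
qed

lemma solution_imp_solves_on:
  assumes coeff: "piecewise_continuous_coefficient (\<lambda>y. \<omega>\<^sup>2 / (c y)\<^sup>2) {y. \<not> isCont c y}"
    and u: "solution c \<omega> u"
  shows "piecewise_continuous_coefficient.solves_on (\<lambda>y. \<omega>\<^sup>2 / (c y)\<^sup>2) {y. \<not> isCont c y}
    a b u (derivative u)"
proof -
  have "(\<forall>y. u differentiable at y) \<and> continuous_on UNIV (derivative u)"
    using u by (simp add: solution_def C1_differentiable_on_eq)
  then have "continuous_on {a..b} (derivative u)" "\<And>y. (u has_vector_derivative derivative u y) (at y)"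
    by (auto intro: continuous_on_subset simp: vector_derivative_works)
  moreover from this have "continuous_on {a..b} u"
    by (meson continuous_at_imp_continuous_on has_vector_derivative_continuous)
  ultimately show ?thesis
    using u by (auto simp: piecewise_continuous_coefficient.solves_on_def[OF coeff] solution_def)
qed

text \<open>
  This turns solutions of the first-order system, such as the one produced by reduction of order,
  into solutions to which the transfer matrix applies.
\<close>

lemma solves_on_imp_solution:
  assumes coeff: "piecewise_continuous_coefficient (\<lambda>y. \<omega>\<^sup>2 / (c y)\<^sup>2) {y. \<not> isCont c y}"
    and v: "\<And>a b. piecewise_continuous_coefficient.solves_on (\<lambda>y. \<omega>\<^sup>2 / (c y)\<^sup>2)
      {y. \<not> isCont c y} a b v z"
    and "v y0 \<noteq> 0"
  shows "solution c \<omega> v" and "derivative v = z"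
proof -
  interpret piecewise_continuous_coefficient "\<lambda>y. \<omega>\<^sup>2 / (c y)\<^sup>2" "{y. \<not> isCont c y}" by (fact coeff)
  have dv: "(v has_vector_derivative z y) (at y)" for y
    by (rule solves_everywhere_imp_C1[OF v])
  then show dz: "derivative v = z" by (auto intro: vector_derivative_at)
  have "isCont z y" for y
  proof -
    have "continuous_on {y-1<..<y+1} z"
      using solves_onD(2)[OF v, of "y-1" "y+1"] by (auto elim: continuous_on_subset)
    then show ?thesis by (simp add: continuous_on_eq_continuous_at)
  qed
  then have "continuous_on UNIV z" by (simp add: continuous_on_eq_continuous_at)
  then have "v C1_differentiable_on UNIV" using dv by (auto simp: C1_differentiable_on_def)
  moreover have "(z has_vector_derivative - (of_real (\<omega>\<^sup>2 / (c y)\<^sup>2) * v y)) (at y)"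
    if "isCont c y" for y
    using solves_onD(4)[OF v, of y "y-1" "y+1"] that by auto
  ultimately show "solution c \<omega> v"
    unfolding solution_def dz
    using assms(3) solves_everywhere_imp_abs_continuous[OF v] by auto
qed

section \<open>Transfer matrix of a symmetric cell\<close>

lemma solves_on_reflect:
  assumes coeff: "piecewise_continuous_coefficient q D"
    and v: "piecewise_continuous_coefficient.solves_on q D a b v z"
    and sym: "\<And>y. y \<in> {a<..<b} \<Longrightarrow> q (a + b - y) = q y"
    and symD: "\<And>y. y \<in> {a<..<b} \<Longrightarrow> a + b - y \<in> D \<longleftrightarrow> y \<in> D"
  shows "piecewise_continuous_coefficient.solves_on q D a b
    (\<lambda>y. v (a + b - y)) (\<lambda>y. - z (a + b - y))"
proof -
  interpret piecewise_continuous_coefficient q D by (fact coeff)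
  have R: "((\<lambda>y. a + b - y) has_vector_derivative -1) (at y)" for y :: real
    by (auto intro!: derivative_eq_intros)
  have C: "continuous_on {a..b} (\<lambda>y. f (a + b - y))" if "continuous_on {a..b} f"
    for f :: "real \<Rightarrow> complex"
    by (rule continuous_on_compose2[OF that]) (auto intro!: continuous_intros)
  show ?thesis
    unfolding solves_on_def
  proof (intro conjI ballI C continuous_on_minus solves_onD[OF v])
    fix y assume y: "y \<in> {a<..<b} - D"
    then have Ry: "a + b - y \<in> {a<..<b} - D \<inter> {a..b}" using symD by auto
    show "((\<lambda>y. v (a + b - y)) has_vector_derivative - z (a + b - y)) (at y)"
      using vector_diff_chain_at[OF R solves_onD(3)[OF v Ry]] by (simp add: o_def)
    show "((\<lambda>y. - z (a + b - y)) has_vector_derivative - (of_real (q y) * v (a + b - y))) (at y)"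
      using has_vector_derivative_minus[OF vector_diff_chain_at[OF R solves_onD(4)[OF v Ry]]]
        sym[of y] y by (simp add: o_def)
  qed
qed

lemma cauchy_data_transfer_iff:
  fixes T :: "real^2^2"
  shows "cauchy_data v b = (\<chi> i j. complex_of_real (T $ i $ j)) *v cauchy_data v a \<longleftrightarrow>
    v b = of_real (T $ 1 $ 1) * v a + of_real (T $ 1 $ 2) * derivative v a \<and>
    derivative v b = of_real (T $ 2 $ 1) * v a + of_real (T $ 2 $ 2) * derivative v a"
  by (simp add: cauchy_data_def vec_eq_iff forall_2 matrix_vector_mult_def sum_2)

text \<open>
  For a second solution \<open>v\<close> with Wronskian \<open>W(u, v) = 1\<close>, equality of \<open>W(u, v)\<close> at the two ends of the
  cell says that the determinant is \<open>1\<close>.  The reflection of \<open>v\<close> in the centre of the cell solves the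
  equation there as well, and has data \<open>(v p', - z p')\<close> at \<open>p\<close> and \<open>(v p, - z p)\<close> at \<open>p'\<close>; equality of its
  Wronskian with \<open>u\<close> at the two ends says that the diagonal entries agree.  Together the two
  identities are equivalent to \<open>T S T = S\<close> with \<open>S = diag (1, -1)\<close>.
\<close>

lemma symmetric_cell_transfer_matrix:
  fixes T :: "real^2^2"
  assumes pos: "\<And>y. c y > 0" and c: "piecewise_smooth_pos c"
    and "p < p'"
    and sym: "\<And>y. y \<in> {p<..<p'} \<Longrightarrow> c (p + p' - y) = c y"
    and u: "solution c \<omega> u"
    and T: "\<And>v. solution c \<omega> v \<Longrightarrow>
      cauchy_data v p' = (\<chi> i j. complex_of_real (T $ i $ j)) *v cauchy_data v p"
  shows "T $ 1 $ 1 = T $ 2 $ 2" and "T $ 1 $ 1 * T $ 2 $ 2 - T $ 1 $ 2 * T $ 2 $ 1 = 1"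
proof -
  let ?q = "\<lambda>y. \<omega>\<^sup>2 / (c y)\<^sup>2" and ?D = "{y. \<not> isCont c y}"
  have coeff: "piecewise_continuous_coefficient ?q ?D"
    by (rule piecewise_smooth_imp_coefficient[OF pos c])
  interpret piecewise_continuous_coefficient ?q ?D by (fact coeff)
  define w where "w = derivative u"
  have su: "solves_on a b u w" for a b
    unfolding w_def by (rule solution_imp_solves_on[OF coeff u])
  obtain y0 where "u y0 \<noteq> 0" using u by (auto simp: solution_def)
  then obtain v z where sv: "\<And>a b. solves_on a b v z" and W: "\<And>y. u y * z y - w y * v y = 1"
    using second_solution[OF su] by blast
  have "\<exists>y. v y \<noteq> 0"
  proof (rule ccontr)
    assume "\<not> ?thesis"
    then have v0: "v = (\<lambda>y. 0)" by auto
    have "(v has_vector_derivative z 0) (at 0)" by (rule solves_everywhere_imp_C1[OF sv])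
    then have "z 0 = 0"
      unfolding v0 by (metis has_vector_derivative_const vector_derivative_at)
    then show False using W[of 0] v0 by simp
  qed
  then obtain y1 where "v y1 \<noteq> 0" by blast
  note v = solves_on_imp_solution[OF coeff sv this]
  have dv: "derivative v y = z y" for y using fun_cong[OF v(2)] .
  define A B C E where "A = complex_of_real (T $ 1 $ 1)" and "B = complex_of_real (T $ 1 $ 2)"
    and "C = complex_of_real (T $ 2 $ 1)" and "E = complex_of_real (T $ 2 $ 2)"
  have Tu: "u p' = A * u p + B * w p" "w p' = C * u p + E * w p"
    using T[OF u] unfolding cauchy_data_transfer_iff A_def B_def C_def E_def w_def by blast+
  have Tv: "v p' = A * v p + B * z p" "z p' = C * v p + E * z p"
    using T[OF v(1)] unfolding cauchy_data_transfer_iff A_def B_def C_def E_def dv by blast+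
  have "A * E - B * C = (A * E - B * C) * (u p * z p - w p * v p)" by (simp add: W)
  also have "\<dots> = u p' * z p' - w p' * v p'" unfolding Tu Tv by (simp add: algebra_simps)
  also have "\<dots> = 1" by (rule W)
  finally show "T $ 1 $ 1 * T $ 2 $ 2 - T $ 1 $ 2 * T $ 2 $ 1 = 1"
    unfolding A_def B_def C_def E_def
    by (simp flip: of_real_mult of_real_diff)
  have symD: "p + p' - y \<in> ?D \<longleftrightarrow> y \<in> ?D" if y: "y \<in> {p<..<p'}" for y
  proof -
    have *: "isCont c (p + p' - t)" if t: "t \<in> {p<..<p'}" and "isCont c t" for t
    proof -
      have "isCont (\<lambda>s. c (p + p' - s)) (p + p' - t)"
        by (rule continuous_at_compose[unfolded o_def]) (use that in \<open>auto intro!: continuous_intros\<close>)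
      moreover have "eventually (\<lambda>s. c (p + p' - s) = c s) (nhds (p + p' - t))"
        by (rule eventually_nhds_in_open[of "{p<..<p'}", THEN eventually_mono]) (use t sym in auto)
      ultimately show ?thesis using isCont_cong by fast
    qed
    show ?thesis using *[of y] *[of "p + p' - y"] y by auto
  qed
  have "solves_on p p' (\<lambda>y. v (p + p' - y)) (\<lambda>y. - z (p + p' - y))"
    by (rule solves_on_reflect[OF coeff sv]) (use sym symD in auto)
  from wronskian_constant[OF _ su this] \<open>p < p'\<close>
  have "u p' * - z p - w p' * v p = u p * - z p' - w p * v p'" by simp
  then have "(A - E) * (u p * z p - w p * v p) = 0" unfolding Tu Tv by (simp add: algebra_simps)
  then show "T $ 1 $ 1 = T $ 2 $ 2" by (simp add: W A_def E_def)
qed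

section \<open>Decaying orbits and localised eigenmodes\<close>

text \<open>
  By the symmetry \<open>T S T = S\<close>, if \<open>V\<close> is an eigenvector for \<open>lam\<close>, then \<open>(V\<^sub>1, - V\<^sub>2)\<close> is one for
  \<open>1 / lam\<close>.  The component of the orbit along the latter grows geometrically unless it is zero, and
  decay of the first coordinate alone suffices to exclude growth, because \<open>V\<close> and \<open>(V\<^sub>1, - V\<^sub>2)\<close> have
  the same first coordinate, nonzero as the eigenvalues differ, and the component along \<open>V\<close> decays
  anyway.
\<close>

lemma decaying_orbit_parallel_eigenvector:
  fixes T :: "real^2^2" and V :: "real^2" and \<xi> \<eta> :: "nat \<Rightarrow> complex"
  assumes diag: "T $ 1 $ 1 = T $ 2 $ 2" and det: "T $ 1 $ 1 * T $ 2 $ 2 - T $ 1 $ 2 * T $ 2 $ 1 = 1"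
    and V: "T *v V = lam *s V" and lam: "\<bar>lam\<bar> < 1"
    and step1: "\<And>n. \<xi> (Suc n) = of_real (T $ 1 $ 1) * \<xi> n + of_real (T $ 1 $ 2) * \<eta> n"
    and step2: "\<And>n. \<eta> (Suc n) = of_real (T $ 2 $ 1) * \<xi> n + of_real (T $ 2 $ 2) * \<eta> n"
    and decay: "\<xi> \<longlonglongrightarrow> 0"
  shows "of_real (V $ 2) * \<xi> 0 = of_real (V $ 1) * \<eta> 0"
proof -
  define a b d where "a = T $ 1 $ 1" and "b = T $ 1 $ 2" and "d = T $ 2 $ 1"
  have T22: "T $ 2 $ 2 = a" using diag by (simp add: a_def)
  have detT: "a * a - b * d = 1" using det diag by (simp add: a_def b_def d_def)
  have eV: "a * V $ 1 + b * V $ 2 = lam * V $ 1" "d * V $ 1 + a * V $ 2 = lam * V $ 2"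
    using V by (simp_all add: vec_eq_iff forall_2 matrix_vector_mult_def sum_2 T22 a_def b_def d_def)
  \<comment> \<open>Up to the factor \<open>2 V\<^sub>1 V\<^sub>2\<close>, these are the coordinates of the orbit along \<open>(V\<^sub>1, - V\<^sub>2)\<close> and
    \<open>(V\<^sub>1, V\<^sub>2)\<close>, so one step multiplies them by \<open>1 / lam\<close> and \<open>lam\<close>.\<close>
  define \<beta> where "\<beta> n = of_real (V $ 2) * \<xi> n - of_real (V $ 1) * \<eta> n" for n
  define \<alpha> where "\<alpha> n = of_real (V $ 2) * \<xi> n + of_real (V $ 1) * \<eta> n" for n
  have \<beta>_step: "of_real lam * \<beta> (Suc n) = \<beta> n" for n
  proof -
    have 1: "lam * (V $ 2 * a - V $ 1 * d) = V $ 2" "lam * (V $ 2 * b - V $ 1 * a) = - (V $ 1)"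
      using eV detT by algebra+
    have "of_real lam * \<beta> (Suc n) = of_real (lam * (V $ 2 * a - V $ 1 * d)) * \<xi> n
        + of_real (lam * (V $ 2 * b - V $ 1 * a)) * \<eta> n"
      by (simp add: \<beta>_def step1 step2 T22 algebra_simps flip: a_def b_def d_def)
    then show ?thesis unfolding 1 by (simp add: \<beta>_def)
  qed
  have \<alpha>_step: "\<alpha> (Suc n) = of_real lam * \<alpha> n" for n
  proof -
    have 1: "V $ 2 * a + V $ 1 * d = lam * V $ 2" "V $ 2 * b + V $ 1 * a = lam * V $ 1"
      using eV by algebra+
    have "\<alpha> (Suc n) = of_real (V $ 2 * a + V $ 1 * d) * \<xi> n
        + of_real (V $ 2 * b + V $ 1 * a) * \<eta> n"
      by (simp add: \<alpha>_def step1 step2 T22 algebra_simps flip: a_def b_def d_def)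
    then show ?thesis unfolding 1 by (simp add: \<alpha>_def algebra_simps)
  qed
  have \<alpha>n: "\<alpha> n = of_real lam ^ n * \<alpha> 0" for n by (induction n) (simp_all add: \<alpha>_step)
  have \<beta>n: "of_real lam ^ n * \<beta> n = \<beta> 0" for n
  proof (induction n)
    case (Suc n)
    have "of_real lam ^ Suc n * \<beta> (Suc n) = of_real lam ^ n * (of_real lam * \<beta> (Suc n))" by simp
    then show ?case by (simp only: \<beta>_step Suc.IH)
  qed simp
  have pow0: "(\<lambda>n. complex_of_real lam ^ n) \<longlonglongrightarrow> 0" by (rule LIMSEQ_power_zero) (simp add: lam)
  \<comment> \<open>Since \<open>\<alpha> + \<beta> = 2 V\<^sub>2 \<xi>\<close>, the constant sequence \<open>lam ^ n * \<beta> n\<close> is expressed through null sequences.\<close>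
  have "(\<lambda>n. of_real lam ^ n * (2 * of_real (V $ 2) * \<xi> n - of_real lam ^ n * \<alpha> 0))
      \<longlonglongrightarrow> 0 * (2 * of_real (V $ 2) * 0 - 0 * \<alpha> 0)"
    by (intro tendsto_intros pow0 decay)
  moreover have "of_real lam ^ n * (2 * of_real (V $ 2) * \<xi> n - of_real lam ^ n * \<alpha> 0) = \<beta> 0" for n
    unfolding \<alpha>n[symmetric] \<beta>n[of n, symmetric] by (simp add: \<alpha>_def \<beta>_def algebra_simps)
  ultimately have "\<beta> 0 = 0" by (simp add: LIMSEQ_const_iff)
  then show ?thesis by (simp add: \<beta>_def)
qed

theorem theorem3p1:
  fixes h \<omega> lamA lamB :: real
    and x :: "int \<Rightarrow> real"
    and c :: "real \<Rightarrow> real"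
    and \<sigma> :: "real set"
    and u :: "real \<Rightarrow> complex"
    and TA TB :: "real^2^2"
    and VA VB :: "real^2"
  assumes "semi_infinite_defect h x c"
    and "spectrum h (medium_A h x c) = \<sigma>"
    and "spectrum h (medium_B h x c) = \<sigma>"
    and "\<omega> \<notin> \<sigma>"
    and "localised_eigenmode c \<omega> u"
    and "transfer_matrix c \<omega> x {n. n < 0} TA"
    and "transfer_matrix c \<omega> x {n. n \<ge> 0} TB"
    and "VA \<noteq> 0" and "TA *v VA = lamA *s VA" and "\<bar>lamA\<bar> < 1"
    and "VB \<noteq> 0" and "TB *v VB = lamB *s VB" and "\<bar>lamB\<bar> < 1"
  shows "VA $ 2 * VB $ 1 + VA $ 1 * VB $ 2 = 0
    \<and> complex_of_real (VB $ 2) * u (x 0) = complex_of_real (VB $ 1) * derivative u (x 0)"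
proof -
  have pos: "\<And>y. c y > 0" and c: "piecewise_smooth_pos c" and h: "h > 0"
    and xh: "\<And>n. x (n + 1) - x n = h"
    and refl: "\<And>n t. t \<in> {0..<h} \<Longrightarrow> c (x n + t) = c (x (n + 1) - t)"
    using assms(1) unfolding semi_infinite_defect_def by blast+
  have u: "solution c \<omega> u" and top: "(u \<longlongrightarrow> 0) at_top" and bot: "(u \<longlongrightarrow> 0) at_bot"
    using assms(5) unfolding localised_eigenmode_def by blast+
  define w where "w = derivative u"
  have cell: "c (x n + x (n + 1) - y) = c y" if "y \<in> {x n<..<x (n + 1)}" for n y
    using refl[of "y - x n" n] that xh[of n] by (simp add: algebra_simps)
  have cell_le: "x n < x (n + 1)" for n using xh[of n] h by linarith
  have TB: "cauchy_data v (x (n + 1)) = (\<chi> i j. complex_of_real (TB $ i $ j)) *v cauchy_data v (x n)"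
    if "solution c \<omega> v" "n \<ge> 0" for v n
    using assms(7) that unfolding transfer_matrix_def by blast
  have TA: "cauchy_data v (x (n + 1)) = (\<chi> i j. complex_of_real (TA $ i $ j)) *v cauchy_data v (x n)"
    if "solution c \<omega> v" "n < 0" for v n
    using assms(6) that unfolding transfer_matrix_def by blast
  note B_sym = symmetric_cell_transfer_matrix[OF pos c cell_le cell u TB, of 0, simplified]
  note A_sym = symmetric_cell_transfer_matrix[OF pos c cell_le cell u TA, of "-1", simplified]
  have x_right: "x (int n) = x 0 + h * real n" for n
  proof (induction n)
    case (Suc n)
    then show ?case using xh[of "int n"] by (simp add: algebra_simps)
  qed simp
  have x_left: "x (- int n) = x 0 - h * real n" for n
  proof (induction n)
    case (Suc n)
    then show ?case using xh[of "- int (Suc n)"] by (simp add: algebra_simps)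
  qed simp
  have hn: "filterlim (\<lambda>n. h * real n) at_top sequentially"
    by (rule filterlim_tendsto_pos_mult_at_top[OF tendsto_const h filterlim_real_sequentially])
  have "filterlim (\<lambda>n. x (int n)) at_top sequentially"
    unfolding x_right by (rule filterlim_tendsto_add_at_top[OF tendsto_const hn])
  then have decay_right: "(\<lambda>n. u (x (int n))) \<longlonglongrightarrow> 0"
    by (rule filterlim_compose[OF top])
  have "filterlim (\<lambda>n. - (- x 0 + h * real n)) at_bot sequentially"
    by (rule filterlim_compose[OF filterlim_uminus_at_bot_at_top
          filterlim_tendsto_add_at_top[OF tendsto_const hn]])
  then have "filterlim (\<lambda>n. x (- int n)) at_bot sequentially"
    by (simp add: x_left)
  then have decay_left: "(\<lambda>n. u (x (- int n))) \<longlonglongrightarrow> 0"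
    by (rule filterlim_compose[OF bot])
  have right: "of_real (VB $ 2) * u (x (int 0)) = of_real (VB $ 1) * w (x (int 0))"
  proof (rule decaying_orbit_parallel_eigenvector
      [OF B_sym assms(12,13) _ _ decay_right, of "\<lambda>n. w (x (int n))"])
    fix n
    have "x (int (Suc n)) = x (int n + 1)" by (simp add: add.commute)
    then show "u (x (int (Suc n))) = of_real (TB $ 1 $ 1) * u (x (int n)) + of_real (TB $ 1 $ 2) * w (x (int n))"
      and "w (x (int (Suc n))) = of_real (TB $ 2 $ 1) * u (x (int n)) + of_real (TB $ 2 $ 2) * w (x (int n))"
      using TB[OF u, of "int n"] unfolding cauchy_data_transfer_iff w_def by simp_all
  qed
  \<comment> \<open>Seen from the right end, the left half-line is a right half-line: replacing \<open>w\<close> by \<open>- w\<close> turns the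
    inverse of \<open>TA\<close> back into \<open>TA\<close>.\<close>
  have left: "of_real (VA $ 2) * u (x (- int 0)) = of_real (VA $ 1) * (- w (x (- int 0)))"
  proof (rule decaying_orbit_parallel_eigenvector
      [OF A_sym assms(9,10) _ _ decay_left, of "\<lambda>n. - w (x (- int n))"])
    fix n
    define A B C where "A = complex_of_real (TA $ 1 $ 1)" and "B = complex_of_real (TA $ 1 $ 2)"
      and "C = complex_of_real (TA $ 2 $ 1)"
    have A22: "complex_of_real (TA $ 2 $ 2) = A" by (simp add: A_def A_sym(1))
    have "A * A - B * C = of_real (TA $ 1 $ 1 * TA $ 2 $ 2 - TA $ 1 $ 2 * TA $ 2 $ 1)"
      by (simp add: A22 flip: A_def B_def C_def)
    then have det: "A * A - B * C = 1" unfolding A_sym(2) by simp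
    have "x (- int n) = x (- int (Suc n) + 1)" by simp
    then have step: "u (x (- int n)) = A * u (x (- int (Suc n))) + B * w (x (- int (Suc n)))"
      "w (x (- int n)) = C * u (x (- int (Suc n))) + A * w (x (- int (Suc n)))"
      using TA[OF u, of "- int (Suc n)"]
      unfolding cauchy_data_transfer_iff w_def A22 A_def[symmetric] B_def[symmetric] C_def[symmetric]
      by simp_all
    have "u (x (- int (Suc n))) = A * u (x (- int n)) + B * (- w (x (- int n)))"
      "- w (x (- int (Suc n))) = C * u (x (- int n)) + A * (- w (x (- int n)))"
      using step det by algebra+
    then show "u (x (- int (Suc n))) =
        of_real (TA $ 1 $ 1) * u (x (- int n)) + of_real (TA $ 1 $ 2) * (- w (x (- int n)))"
      and "- w (x (- int (Suc n))) =
        of_real (TA $ 2 $ 1) * u (x (- int n)) + of_real (TA $ 2 $ 2) * (- w (x (- int n)))"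
      unfolding A22 by (simp_all only: A_def B_def C_def)
  qed
  have nonzero: "u (x 0) \<noteq> 0 \<or> w (x 0) \<noteq> 0"
  proof -
    have coeff: "piecewise_continuous_coefficient (\<lambda>y. \<omega>\<^sup>2 / (c y)\<^sup>2) {y. \<not> isCont c y}"
      by (rule piecewise_smooth_imp_coefficient[OF pos c])
    obtain y0 where "u y0 \<noteq> 0" using u by (auto simp: solution_def)
    then show ?thesis
      unfolding w_def by (rule piecewise_continuous_coefficient.cauchy_data_nonzero
          [OF coeff solution_imp_solves_on[OF coeff u]])
  qed
  \<comment> \<open>The two conditions at \<open>x 0\<close> form a homogeneous linear system with a nonzero solution.\<close>
  define s where "s = complex_of_real (VA $ 2 * VB $ 1 + VA $ 1 * VB $ 2)"
  have "s * u (x 0) = 0" "s * w (x 0) = 0"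
    using left right unfolding s_def of_real_add of_real_mult by (simp_all, algebra+)
  then have "s = 0" using nonzero by auto
  then have "VA $ 2 * VB $ 1 + VA $ 1 * VB $ 2 = 0"
    unfolding s_def by (simp only: of_real_eq_0_iff)
  then show ?thesis using right by (simp add: w_def)
qed

end
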